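(* Let $(X,d)$ be a compact metric space, $Y$ a compact subset of $X$, $f\colon X\to X$ a homeomorphism, and $\varphi\colon X\to\mathbb{R}$ a continuous function. Let $\mathfrak{F}$ be a flip-flop family associated to $\varphi$ and $f$ having sojourns along $Y$, let $D\in\mathfrak{F}$, and let $x_D\in D$ be a point controlled at any scale with a long sparse tail with respect to $\varphi$ and $Y$. Then any measure $\mu$ that is a weak$\ast$ limit of the empirical measures $(\mu_n(x_D))_n$ satisfies: - the orbit of $\mu$-almost every point is dense in $Y$; and - for $\mu$-almost every point $x$, $\varphi_\infty(x)=\lim_{n\to+\infty}\frac1n\sum_{i=0}^{n-1}\varphi(f^i(x))=0$. As a consequence, almost every measure $\nu$ in the ergodic decomposition of $\mu$ has full support in $Y$ and satisfies $\int\varphi\,d\nu=0$.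
   Context: Conventions: $\mu_n(x)=\frac1n\sum_{i=0}^{n-1}\delta(f^i(x))$ with $\delta(y)$ the Dirac measure at $y$; a weak$\ast$ limit of $(\mu_n(x))_n$ means the weak$\ast$ limit of a subsequence. A set is $\delta$-dense in $Y$ if its $\delta$-neighbourhood contains $Y$; dense in $Y$ means that its closure contains $Y$; a measure has full support in $Y$ if its support contains $Y$. Flip-flop family: a flip-flop family associated to $\varphi$ and $f$ is a family $\mathfrak{F}=\mathfrak{F}^+\sqcup\mathfrak{F}^-$ of non-empty compact subsets of $X$ (called plaques) such that there are $\alpha>0$ and positive numbers $\zeta_n\to0$ with: (1) $\varphi(x)\ge\alpha$ for every $x\in D\in\mathfrak{F}^+$, and $\varphi(x)\le-\alpha$ for every $x\in D\in\mathfrak{F}^-$; (2) for every $D\in\mathfrak{F}$ there are $D^+\in\mathfrak{F}^+$ and $D^-\in\mathfrak{F}^-$ contained in $f(D)$; (3) for every $n>0$ and every $D_0,\dots,D_n\in\mathfrak{F}$ with $D_{i+1}\subset f(D_i)$, one has $d(f^{n-i}(x),f^{n-i}(y))\le\zeta_i\,d(f^n(x),f^n(y))$ for every $i\in\{0,\dots,n\}$ and $x,y\in f^{-n}(D_n)$. Sojourns along $Y$: for every $\delta>0$ there is an integer $N=N_\delta$ such that every $D\in\mathfrak{F}$ contains subsets $\widehat D^+,\widehat D^-$ with: (1) for every $x\in\widehat D^+\cup\widehat D^-$ the orbit segment $\{x,\dots,f^N(x)\}$ is $\delta$-dense in $Y$; (2) $f^N(\widehat D^+)\in\mathfrak{F}^+$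 and $f^N(\widehat D^-)\in\mathfrak{F}^-$; (3) for every $i\in\{0,\dots,N\}$ and every $x,y\in\widehat D^+$ or $x,y\in\widehat D^-$, $d(f^{N-i}(x),f^{N-i}(y))\le\zeta_i\,d(f^N(x),f^N(y))$, with $(\zeta_i)_i$ a sequence as in the definition of flip-flop family. Notation: $[a,b]_{\mathbb{N}}=[a,b]\cap\mathbb{N}$, with $0\in\mathbb{N}$. A component of $S\subset\mathbb{N}$ is an interval of integers $[a,b]_{\mathbb{N}}\subset S$ with $a-1,b+1\notin S$. Scale: a sequence $\mathcal{T}=(T_n)_{n\ge0}$ of positive integers such that there are integers $\kappa_n\ge3$ ($n\ge1$) with $T_n=\kappa_nT_{n-1}$ and $\kappa_{n+1}/\kappa_n\to\infty$; moreover $T_0$ (hence every $T_n$) is a multiple of $3$. Controlling sequence: a sequence $\bar\varepsilon=(\varepsilon_n)_n$ of positive numbers converging to $0$ with $\sum_n\varepsilon_n<\infty$ and $\prod_n(1-\varepsilon_n)>0$. $\mathcal{T}$-long $\bar\varepsilon$-sparse tail: a set $R_\infty\subset\mathbb{N}$ such that: (a) every component of $R_\infty$ is of the form $[kT_n,(k+1)T_n-1]_{\mathbb{N}}$ for some $k,n$ (it has size $T_n$). Let $R_n$ be the union of the components of size $T_n$ and $R_{n,\infty}=\bigcup_{i\ge n}R_i$; (b) $0\notin R_\infty$; (c) for every interval $I=[kT_n,(k+1)T_n-1]_{\mathbb{N}}$, $n\ge1$, $k\ge0$, not contained in any component of $R_\infty$: $[kT_n,kT_n+\frac{T_n}{3}]\cap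 R_{n-1}=\emptyset=[((k+1)T_n-1)-\frac{T_n}{3},(k+1)T_n-1]\cap R_{n-1}$ and $0<\frac{\#(R_{n-1}\cap I)}{T_n}<\varepsilon_n$. Controlled point: $x\in X$ is controlled at any scale with a long sparse tail with respect to $\varphi$ and $Y$ if there are a scale $\mathcal{T}$, a controlling sequence $\bar\varepsilon$, a $\mathcal{T}$-long $\bar\varepsilon$-sparse tail $R_\infty$, and decreasing sequences $(\delta_n)_n$, $(\alpha_n)_n$ of positive numbers converging to $0$ such that: (i) for every component $I$ of $R_\infty$ of size $T_n$, the orbit segment $\{f^i(x):i\in I\}$ is $\delta_n$-dense in $Y$; (ii) for every interval $I=[kT_n,(k+1)T_n-1]_{\mathbb{N}}$ with $I\not\subset R_{n+1,\infty}$, one has $\frac1{T_n}\sum_{i\in I}\varphi(f^i(x))\in[-\alpha_n,\alpha_n]$. *)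

theory Defs
  imports "HOL-Probability.Probability"
begin

text \<open>
  The ambient space is a type of class \<open>metric_space\<close>; compactness is the assumption
  \<open>compact UNIV\<close> of the theorem. Measures on it are Borel measures, i.e.\ satisfy
  \<open>sets M = sets borel\<close>. The iterate \<open>f\<^sup>i\<close> is \<open>f ^^ i\<close>.
\<close>

section \<open>Density, supports and empirical measures\<close>

definition delta_dense :: "real \<Rightarrow> 'a::metric_space set \<Rightarrow> 'a set \<Rightarrow> bool" where
  "delta_dense \<delta> S Y \<longleftrightarrow> Y \<subseteq> (\<Union>s\<in>S. ball s \<delta>)"

definition dense_in :: "'a::topological_space set \<Rightarrow> 'a set \<Rightarrow> bool" where
  "dense_in S Y \<longleftrightarrow> Y \<subseteq> closure S"

definition forward_orbit :: "('a \<Rightarrow> 'a) \<Rightarrow> 'a \<Rightarrow> 'a set" where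
  "forward_orbit f x = range (\<lambda>i::nat. (f ^^ i) x)"

definition measure_support :: "'a::topological_space measure \<Rightarrow> 'a set" where
  "measure_support M = {x. \<forall>U. open U \<and> x \<in> U \<longrightarrow> emeasure M U > 0}"

definition full_support_in :: "'a::topological_space measure \<Rightarrow> 'a set \<Rightarrow> bool" where
  "full_support_in M Y \<longleftrightarrow> Y \<subseteq> measure_support M"

definition birkhoff_average :: "('a \<Rightarrow> 'a) \<Rightarrow> ('a \<Rightarrow> real) \<Rightarrow> nat \<Rightarrow> 'a \<Rightarrow> real" where
  "birkhoff_average f \<phi> n x = (\<Sum>i<n. \<phi> ((f ^^ i) x)) / real n"

text \<open>
  The measure \<open>\<mu>\<^sub>n(x)\<close> is the push-forward of the uniform probability on \<open>{0,\<dots>,n-1}\<close>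
  under \<open>i \<mapsto> f\<^sup>i(x)\<close>; the lemma below recovers the average of Dirac measures. The value
  at \<open>n = 0\<close> is irrelevant.
\<close>

definition empirical_measure ::
    "('a::topological_space \<Rightarrow> 'a) \<Rightarrow> nat \<Rightarrow> 'a \<Rightarrow> 'a measure" where
  "empirical_measure f n x = distr (uniform_count_measure {..<n}) borel (\<lambda>i. (f ^^ i) x)"

lemma emeasure_empirical_measure:
  fixes f :: "'a::topological_space \<Rightarrow> 'a"
  assumes "n > 0" and A: "A \<in> sets borel"
  shows "emeasure (empirical_measure f n x) A
    = (\<Sum>i<n. emeasure (return borel ((f ^^ i) x)) A) / of_nat n"
proof -
  let ?B = "{i. i < n \<and> (f ^^ i) x \<in> A}"
  have "emeasure (empirical_measure f n x) A = emeasure (uniform_count_measure {..<n}) ?B"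
    unfolding empirical_measure_def
    by (subst emeasure_distr)
       (auto simp: A space_uniform_count_measure sets_uniform_count_measure measurable_def
          intro!: arg_cong[where f = "emeasure _"])
  also have "\<dots> = of_nat (card ?B) / of_nat n"
    using assms(1) by (subst emeasure_uniform_count_measure)
      (auto simp: divide_ennreal ennreal_of_nat_eq_real_of_nat)
  also have "(of_nat (card ?B) :: ennreal) = (\<Sum>i<n. indicator A ((f ^^ i) x))"
  proof -
    have "?B = {..<n} \<inter> {i. (f ^^ i) x \<in> A}" by auto
    then show ?thesis by (simp add: indicator_def sum.If_cases)
  qed
  finally show ?thesis by (simp add: A)
qed

definition weak_star_limit_of_subsequence ::
    "(nat \<Rightarrow> 'a::topological_space measure) \<Rightarrow> 'a measure \<Rightarrow> bool" where
  "weak_star_limit_of_subsequence M \<mu> \<longleftrightarrow>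
     sets \<mu> = sets borel \<and> prob_space \<mu> \<and>
     (\<exists>r::nat \<Rightarrow> nat. strict_mono r \<and>
        (\<forall>g::'a \<Rightarrow> real. continuous_on UNIV g \<longrightarrow>
           (\<lambda>n. integral\<^sup>L (M (r n)) g) \<longlonglongrightarrow> integral\<^sup>L \<mu> g))"

section \<open>Ergodic measures and ergodic decompositions\<close>

definition invariant_prob :: "('a::topological_space \<Rightarrow> 'a) \<Rightarrow> 'a measure \<Rightarrow> bool" where
  "invariant_prob f \<nu> \<longleftrightarrow>
     sets \<nu> = sets borel \<and> prob_space \<nu> \<and>
     (\<forall>A\<in>sets borel. emeasure \<nu> (f -` A) = emeasure \<nu> A)"

definition ergodic_prob :: "('a::topological_space \<Rightarrow> 'a) \<Rightarrow> 'a measure \<Rightarrow> bool" where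
  "ergodic_prob f \<nu> \<longleftrightarrow>
     invariant_prob f \<nu> \<and>
     (\<forall>A\<in>sets borel. f -` A = A \<longrightarrow> measure \<nu> A = 0 \<or> measure \<nu> A = 1)"

text \<open>
  A probability \<open>P\<close> on the space of Borel probabilities, concentrated on the ergodic ones and
  with barycentre \<open>\<mu>\<close>. For a homeomorphism of a compact metric space and an invariant \<open>\<mu>\<close>
  such a \<open>P\<close> exists and is unique.
\<close>

definition ergodic_decomposition ::
    "('a::topological_space \<Rightarrow> 'a) \<Rightarrow> 'a measure \<Rightarrow> 'a measure measure \<Rightarrow> bool" where
  "ergodic_decomposition f \<mu> P \<longleftrightarrow>
     sets P = sets (prob_algebra borel) \<and> prob_space P \<and>
     (AE \<nu> in P. ergodic_prob f \<nu>) \<and>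
     (\<forall>A\<in>sets borel. emeasure \<mu> A = (\<integral>\<^sup>+ \<nu>. emeasure \<nu> A \<partial>P))"

section \<open>Flip-flop families and sojourns\<close>

text \<open>A family of plaques is given by its two parts \<open>Fp\<close> (positive) and \<open>Fm\<close> (negative).\<close>

definition contraction_rates :: "(nat \<Rightarrow> real) \<Rightarrow> bool" where
  "contraction_rates \<zeta> \<longleftrightarrow> (\<forall>n. \<zeta> n > 0) \<and> \<zeta> \<longlonglongrightarrow> 0"

definition flip_flop_family ::
    "('a::metric_space \<Rightarrow> 'a) \<Rightarrow> ('a \<Rightarrow> real) \<Rightarrow> 'a set set \<Rightarrow> 'a set set \<Rightarrow> bool" where
  "flip_flop_family f \<phi> Fp Fm \<longleftrightarrow>
     Fp \<inter> Fm = {} \<and>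
     (\<forall>D\<in>Fp \<union> Fm. D \<noteq> {} \<and> compact D) \<and>
     (\<exists>\<alpha>>0. \<exists>\<zeta>. contraction_rates \<zeta> \<and>
        (\<forall>D\<in>Fp. \<forall>x\<in>D. \<phi> x \<ge> \<alpha>) \<and>
        (\<forall>D\<in>Fm. \<forall>x\<in>D. \<phi> x \<le> - \<alpha>) \<and>
        (\<forall>D\<in>Fp \<union> Fm. (\<exists>Dp\<in>Fp. Dp \<subseteq> f ` D) \<and> (\<exists>Dm\<in>Fm. Dm \<subseteq> f ` D)) \<and>
        (\<forall>n>0. \<forall>D::nat \<Rightarrow> 'a set.
           (\<forall>i\<le>n. D i \<in> Fp \<union> Fm) \<and> (\<forall>i<n. D (Suc i) \<subseteq> f ` D i) \<longrightarrow>
           (\<forall>i\<le>n. \<forall>x\<in>(f ^^ n) -` D n. \<forall>y\<in>(f ^^ n) -` D n.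
              dist ((f ^^ (n - i)) x) ((f ^^ (n - i)) y)
                \<le> \<zeta> i * dist ((f ^^ n) x) ((f ^^ n) y))))"

text \<open>
  The sequence \<open>\<zeta>\<close> below is not tied to the one witnessing \<open>flip_flop_family\<close>; this is no
  loss, since the pointwise maximum of the two sequences witnesses both conditions.
\<close>

definition sojourns_along ::
    "('a::metric_space \<Rightarrow> 'a) \<Rightarrow> 'a set set \<Rightarrow> 'a set set \<Rightarrow> 'a set \<Rightarrow> bool" where
  "sojourns_along f Fp Fm Y \<longleftrightarrow>
     (\<exists>\<zeta>. contraction_rates \<zeta> \<and>
       (\<forall>\<delta>>0. \<exists>N::nat. \<forall>D\<in>Fp \<union> Fm. \<exists>Dp Dm. Dp \<subseteq> D \<and> Dm \<subseteq> D \<and>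
          (\<forall>x\<in>Dp \<union> Dm. delta_dense \<delta> ((\<lambda>i. (f ^^ i) x) ` {0..N}) Y) \<and>
          (f ^^ N) ` Dp \<in> Fp \<and> (f ^^ N) ` Dm \<in> Fm \<and>
          (\<forall>i\<le>N. \<forall>x y. (x \<in> Dp \<and> y \<in> Dp) \<or> (x \<in> Dm \<and> y \<in> Dm) \<longrightarrow>
             dist ((f ^^ (N - i)) x) ((f ^^ (N - i)) y)
               \<le> \<zeta> i * dist ((f ^^ N) x) ((f ^^ N) y))))"

section \<open>Scales, sparse tails and controlled points\<close>

text \<open>The disjunct \<open>a = 0\<close> accounts for \<open>a - 1\<close> not being a natural number then.\<close>

definition is_component :: "nat set \<Rightarrow> nat set \<Rightarrow> bool" where
  "is_component S I \<longleftrightarrow>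
     (\<exists>a b. a \<le> b \<and> I = {a..b} \<and> I \<subseteq> S \<and> (a = 0 \<or> a - 1 \<notin> S) \<and> b + 1 \<notin> S)"

definition scale :: "(nat \<Rightarrow> nat) \<Rightarrow> bool" where
  "scale T \<longleftrightarrow>
     (\<forall>n. T n > 0) \<and> 3 dvd T 0 \<and>
     (\<exists>\<kappa>::nat \<Rightarrow> nat. (\<forall>n\<ge>1. \<kappa> n \<ge> 3 \<and> T n = \<kappa> n * T (n - 1)) \<and>
        filterlim (\<lambda>n. real (\<kappa> (Suc n)) / real (\<kappa> n)) at_top sequentially)"

definition controlling_sequence :: "(nat \<Rightarrow> real) \<Rightarrow> bool" where
  "controlling_sequence \<epsilon> \<longleftrightarrow>
     (\<forall>n. \<epsilon> n > 0) \<and> \<epsilon> \<longlonglongrightarrow> 0 \<and> summable \<epsilon> \<and>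
     (\<exists>p>0. (\<lambda>n. 1 - \<epsilon> n) has_prod p)"

definition scale_interval :: "(nat \<Rightarrow> nat) \<Rightarrow> nat \<Rightarrow> nat \<Rightarrow> nat set" where
  "scale_interval T n k = {k * T n .. (k + 1) * T n - 1}"

definition tail_level :: "(nat \<Rightarrow> nat) \<Rightarrow> nat set \<Rightarrow> nat \<Rightarrow> nat set" where
  "tail_level T R n = \<Union>{I. is_component R I \<and> card I = T n}"

definition tail_from :: "(nat \<Rightarrow> nat) \<Rightarrow> nat set \<Rightarrow> nat \<Rightarrow> nat set" where
  "tail_from T R n = (\<Union>i\<in>{n..}. tail_level T R i)"

text \<open>The division by 3 below is exact, as a scale consists of multiples of 3.\<close>

definition long_sparse_tail :: "(nat \<Rightarrow> nat) \<Rightarrow> (nat \<Rightarrow> real) \<Rightarrow> nat set \<Rightarrow> bool" where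
  "long_sparse_tail T \<epsilon> R \<longleftrightarrow>
     (\<forall>I. is_component R I \<longrightarrow> (\<exists>k n. I = scale_interval T n k)) \<and>
     0 \<notin> R \<and>
     (\<forall>n\<ge>1. \<forall>k. (\<nexists>C. is_component R C \<and> scale_interval T n k \<subseteq> C) \<longrightarrow>
        {k * T n .. k * T n + T n div 3} \<inter> tail_level T R (n - 1) = {} \<and>
        {((k + 1) * T n - 1) - T n div 3 .. (k + 1) * T n - 1}
           \<inter> tail_level T R (n - 1) = {} \<and>
        0 < real (card (tail_level T R (n - 1) \<inter> scale_interval T n k)) / real (T n) \<and>
        real (card (tail_level T R (n - 1) \<inter> scale_interval T n k)) / real (T n) < \<epsilon> n)"

text \<open>
  Decreasing is read as non-increasing; adding \<open>1/(n+1)\<close> turns such sequences into strictly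
  decreasing ones with the same properties.
\<close>

definition controlled_with_long_sparse_tail ::
    "('a::metric_space \<Rightarrow> 'a) \<Rightarrow> ('a \<Rightarrow> real) \<Rightarrow> 'a set \<Rightarrow> 'a \<Rightarrow> bool" where
  "controlled_with_long_sparse_tail f \<phi> Y x \<longleftrightarrow>
     (\<exists>T \<epsilon> R \<delta> \<alpha>.
        scale T \<and> controlling_sequence \<epsilon> \<and> long_sparse_tail T \<epsilon> R \<and>
        decseq \<delta> \<and> (\<forall>n. \<delta> n > 0) \<and> \<delta> \<longlonglongrightarrow> 0 \<and>
        decseq \<alpha> \<and> (\<forall>n. \<alpha> n > 0) \<and> \<alpha> \<longlonglongrightarrow> 0 \<and>
        (\<forall>n I. is_component R I \<and> card I = T n \<longrightarrow>
           delta_dense (\<delta> n) ((\<lambda>i. (f ^^ i) x) ` I) Y) \<and>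
        (\<forall>n k. \<not> scale_interval T n k \<subseteq> tail_from T R (n + 1) \<longrightarrow>
           (\<Sum>i\<in>scale_interval T n k. \<phi> ((f ^^ i) x)) / real (T n) \<in> {- \<alpha> n .. \<alpha> n}))"

end

theory Submission
  imports Defs
begin

text \<open>
  The point \<open>x\<close> is controlled with scale \<open>T\<close> and sparse tail \<open>R\<close>. Write \<open>R\<^sub>p\<close> for the union of
  the components of \<open>R\<close> of size at least \<open>T p\<close>. The quantitative input is that \<open>R\<^sub>p\<close> occupies
  at most a proportion \<open>4 (\<epsilon>\<^bsub>p+1\<^esub> + \<epsilon>\<^bsub>p+2\<^esub> + \<dots>)\<close> of every initial segment of times
  (\<open>card_tail_from_le\<close>). This tends to \<open>0\<close> as \<open>p\<close> grows. Both almost sure properties are then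
  obtained by showing that, at all times outside a set of small density, the orbit of \<open>x\<close> lies in
  a closed set of points that have the desired property with an explicit quantifier; a weak limit
  of the empirical measures gives large mass to this closed set (\<open>weak_star_limit_closed\<close>).

  For density in \<open>Y\<close>: unless \<open>i + T (n + 1)\<close> belongs to \<open>R\<^sub>p\<close>, a component of size \<open>T n\<close> occurs
  in the window from \<open>i\<close> to \<open>i + 2 T (n + 1) + T p\<close> (\<open>component_in_window\<close>). The corresponding
  finite piece of orbit is \<open>\<delta>\<^sub>n\<close>-dense in \<open>Y\<close>, and its length does not depend on \<open>i\<close>.

  For the Birkhoff averages: the sum of \<open>\<phi>\<close> along the times from \<open>i\<close> to \<open>i + N\<close> is small compared
  with \<open>N\<close> as soon as \<open>N\<close> is large compared with \<open>T n\<close> and \<open>R\<^bsub>n+1\<^esub>\<close> has small frequency in this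
  interval (\<open>sum_le_by_blocks\<close>). A discrete maximal inequality shows that, up to a set of \<open>i\<close> of
  small density, the latter holds for all \<open>N\<close> up to any prescribed bound. Letting this bound tend to
  infinity controls all large \<open>N\<close> simultaneously, so that the ergodic theorem is not needed.

  A null set of \<open>\<mu>\<close> is null for almost every measure \<open>\<nu>\<close> of an ergodic decomposition of \<open>\<mu>\<close>, so the
  two properties hold \<open>\<nu>\<close>-almost everywhere. By invariance of \<open>\<nu>\<close>, an open set that meets almost
  every orbit has positive mass, and all the Birkhoff averages have integral \<open>\<integral>\<phi> d\<nu>\<close>, which must then
  be \<open>0\<close> by dominated convergence.
\<close>

section \<open>Weak limits of empirical measures\<close>

lemma integral_empirical_measure:
  fixes f :: "'a::topological_space \<Rightarrow> 'a" and h :: "'a \<Rightarrow> real"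
  assumes "h \<in> borel_measurable borel"
  shows "integral\<^sup>L (empirical_measure f n x) h = (\<Sum>i<n. h ((f ^^ i) x)) / real n"
proof -
  have "(\<lambda>i. (f ^^ i) x) \<in> uniform_count_measure {..<n} \<rightarrow>\<^sub>M borel"
    by (auto simp: measurable_def space_uniform_count_measure sets_uniform_count_measure)
  then show ?thesis
    unfolding empirical_measure_def using assms
    by (simp add: integral_distr integral_uniform_count_measure)
qed

text \<open>
  The portmanteau inequality for closed sets: if the orbit visits a closed set with lower
  frequency at least \<open>c\<close>, then every weak limit of the empirical measures gives it mass at
  least \<open>c\<close>. The indicator of the set is approximated from above by Lipschitz functions.
\<close>

lemma weak_star_limit_closed:
  fixes f :: "'a::metric_space \<Rightarrow> 'a"
  assumes lim: "weak_star_limit_of_subsequence (\<lambda>n. empirical_measure f n x) \<mu>"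
    and K: "closed K"
    and freq: "\<And>t. c * real t - C \<le> real (card {i. i < t \<and> (f ^^ i) x \<in> K})"
  shows "c \<le> measure \<mu> K"
proof (cases "K = {}")
  case True
  have "c \<le> 0"
  proof (rule ccontr)
    assume "\<not> c \<le> 0"
    then obtain t :: nat where "C < real t * c"
      using reals_Archimedean3[of c] by (auto simp: not_le)
    with freq[of t] True show False by (simp add: mult.commute)
  qed
  with True show ?thesis by simp
next
  case False
  from lim obtain r where sets: "sets \<mu> = sets borel" and prob: "prob_space \<mu>"
    and r: "strict_mono r"
    and conv: "\<And>h::'a \<Rightarrow> real. continuous_on UNIV h \<Longrightarrow>
      (\<lambda>n. integral\<^sup>L (empirical_measure f (r n) x) h) \<longlonglongrightarrow> integral\<^sup>L \<mu> h"
    unfolding weak_star_limit_of_subsequence_def by blast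
  interpret prob_space \<mu> by fact
  define h where "h k z = max 0 (1 - real k * infdist z K)" for k z
  have cont: "continuous_on UNIV (h k)" for k
    unfolding h_def by (intro continuous_intros)
  have meas: "h k \<in> borel_measurable borel" for k
    by (rule borel_measurable_continuous_onI) (rule cont)
  have bounds: "0 \<le> h k z" "h k z \<le> 1" for k z
    by (auto simp: h_def infdist_nonneg)
  have one: "h k z = 1" if "z \<in> K" for k z
    using that by (simp add: h_def)
  have ge: "c \<le> integral\<^sup>L \<mu> (h k)" for k
  proof (rule tendsto_le[OF sequentially_bot conv[OF cont]])
    have "(\<lambda>n. c - C / real (r n)) \<longlonglongrightarrow> c - 0"
      using filterlim_compose[OF filterlim_real_sequentially filterlim_subseq[OF r]]
      by (intro tendsto_intros tendsto_divide_0[OF tendsto_const] filterlim_at_top_imp_at_infinity)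
    then show "(\<lambda>n. c - C / real (r n)) \<longlonglongrightarrow> c" by simp
    show "\<forall>\<^sub>F n in sequentially.
        c - C / real (r n) \<le> integral\<^sup>L (empirical_measure f (r n) x) (h k)"
    proof (rule eventually_sequentiallyI[of 1])
      fix n :: nat assume "1 \<le> n"
      then have pos: "0 < r n" using seq_suble[OF r, of n] by simp
      let ?A = "{i. i < r n \<and> (f ^^ i) x \<in> K}"
      have "c * real (r n) - C \<le> real (card ?A)" by (rule freq)
      also have "\<dots> = (\<Sum>i\<in>?A. h k ((f ^^ i) x))" by (simp add: one)
      also have "\<dots> \<le> (\<Sum>i<r n. h k ((f ^^ i) x))"
        by (rule sum_mono2) (auto simp: bounds)
      finally have "(c * real (r n) - C) / real (r n)
          \<le> (\<Sum>i<r n. h k ((f ^^ i) x)) / real (r n)"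
        by (rule divide_right_mono) simp
      then show "c - C / real (r n) \<le> integral\<^sup>L (empirical_measure f (r n) x) (h k)"
        using pos by (simp add: integral_empirical_measure[OF meas] diff_divide_distrib)
    qed
  qed
  have "(\<lambda>k. integral\<^sup>L \<mu> (h k)) \<longlonglongrightarrow> integral\<^sup>L \<mu> (indicat_real K)"
  proof (rule integral_dominated_convergence[where w = "\<lambda>_. 1"])
    show "AE z in \<mu>. (\<lambda>k. h k z) \<longlonglongrightarrow> indicat_real K z"
    proof (rule AE_I2)
      fix z
      show "(\<lambda>k. h k z) \<longlonglongrightarrow> indicat_real K z"
      proof (cases "z \<in> K")
        case True then show ?thesis by (simp add: one)
      next
        case notin: False
        have d: "0 < infdist z K"
          using infdist_pos_not_in_closed[OF K False notin] .
        obtain k0 :: nat where k0: "1 < real k0 * infdist z K"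
          using reals_Archimedean3[OF d] by blast
        have "h k z = 0" if "k0 \<le> k" for k
        proof -
          have "real k0 * infdist z K \<le> real k * infdist z K"
            using that d by (intro mult_right_mono) auto
          with k0 show ?thesis by (simp add: h_def)
        qed
        then have "\<forall>\<^sub>F k in sequentially. h k z = 0"
          by (rule eventually_sequentiallyI)
        then show ?thesis using notin by (simp add: tendsto_eventually)
      qed
    qed
  qed (use K sets meas bounds in \<open>auto simp: borel_measurable_indicator
        cong: measurable_cong_sets\<close>)
  moreover have "integral\<^sup>L \<mu> (indicat_real K) = measure \<mu> K"
    using sets_eq_imp_space_eq[OF sets] by simp
  ultimately show ?thesis
    using ge by (auto intro: LIMSEQ_le_const)
qed

text \<open>
  Only inner approximation by closed sets is used, so the property itself need not be measurable.
\<close>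

lemma AE_of_large_closed_sets:
  assumes "prob_space \<mu>" and sets: "sets \<mu> = sets borel"
    and large: "\<And>e::real. 0 < e \<Longrightarrow> \<exists>K. closed K \<and> 1 - e \<le> measure \<mu> K \<and> (\<forall>x\<in>K. P x)"
  shows "AE x in \<mu>. P x"
proof -
  interpret prob_space \<mu> by fact
  have "\<forall>m::nat. \<exists>K. closed K \<and> 1 - 1 / real (Suc m) \<le> measure \<mu> K \<and> (\<forall>x\<in>K. P x)"
    by (intro allI large) simp
  then obtain K where K: "\<And>m::nat. closed (K m)"
    "\<And>m. 1 - 1 / real (Suc m) \<le> measure \<mu> (K m)" "\<And>m x. x \<in> K m \<Longrightarrow> P x"
    by metis
  have Ks: "K m \<in> events" for m using K(1) sets by auto
  let ?N = "space \<mu> - (\<Union>m. K m)"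
  have N: "?N \<in> events" using Ks by auto
  have "prob ?N \<le> 1 / real (Suc m)" for m
  proof -
    have "prob ?N \<le> prob (space \<mu> - K m)"
      using Ks by (intro finite_measure_mono) auto
    also have "\<dots> \<le> 1 / real (Suc m)" using K(2)[of m] Ks by (simp add: prob_compl)
    finally show ?thesis .
  qed
  then have "prob ?N \<le> 0"
    by (intro LIMSEQ_le_const[OF LIMSEQ_Suc[OF lim_1_over_n]]) auto
  then have "prob ?N = 0" using measure_nonneg[of \<mu> ?N] by linarith
  then have "?N \<in> null_sets \<mu>"
    using N by (auto simp: null_sets_def emeasure_eq_measure)
  then show ?thesis using K(3) by (elim AE_I') auto
qed

section \<open>Two facts on finite sums over the integers\<close>

text \<open>
  A one-sided discrete maximal inequality. Going from left to right, each point of the set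
  on the left starts an interval of length at most \<open>L\<close> in which \<open>S\<close> has frequency at least
  \<open>\<beta>\<close>; these intervals can be taken disjoint.
\<close>

lemma discrete_maximal_inequality:
  fixes S :: "nat set" and \<beta> :: real
  assumes \<beta>: "0 \<le> \<beta>"
  shows "\<beta> * real (card {i\<in>{a..<t}. \<exists>N. 1 \<le> N \<and> N \<le> L \<and>
            \<beta> * real N \<le> real (card (S \<inter> {i..<i + N}))})
          \<le> real (card (S \<inter> {a..<t + L}))"
proof -
  define B where "B = {i. \<exists>N. 1 \<le> N \<and> N \<le> L \<and> \<beta> * real N \<le> real (card (S \<inter> {i..<i + N}))}"
  have "\<beta> * real (card (B \<inter> {a..<t})) \<le> real (card (S \<inter> {a..<t + L}))"
  proof (induction "t - a" arbitrary: a rule: less_induct)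
    case less
    consider "t \<le> a" | "a < t" "a \<notin> B" | "a < t" "a \<in> B" by linarith
    then show ?case
    proof cases
      case 1
      then show ?thesis by simp
    next
      case 2
      then have "{a..<t} = insert a {Suc a..<t}" by auto
      then have "B \<inter> {a..<t} = B \<inter> {Suc a..<t}" using 2 by auto
      moreover have "card (S \<inter> {Suc a..<t + L}) \<le> card (S \<inter> {a..<t + L})"
        by (intro card_mono) auto
      ultimately show ?thesis using less[of "Suc a"] 2(1) by fastforce
    next
      case 3
      then obtain N where N: "1 \<le> N" "N \<le> L"
        "\<beta> * real N \<le> real (card (S \<inter> {a..<a + N}))"
        by (auto simp: B_def)
      have "card (B \<inter> {a..<t}) \<le> card ({a..<a + N} \<union> (B \<inter> {a + N..<t}))"
        by (intro card_mono) auto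
      also have "\<dots> \<le> N + card (B \<inter> {a + N..<t})"
        using card_Un_le[of "{a..<a + N}" "B \<inter> {a + N..<t}"] by simp
      finally have "real (card (B \<inter> {a..<t})) \<le> real N + real (card (B \<inter> {a + N..<t}))"
        by linarith
      then have "\<beta> * real (card (B \<inter> {a..<t}))
          \<le> \<beta> * (real N + real (card (B \<inter> {a + N..<t})))"
        using \<beta> by (rule mult_left_mono)
      also have "\<dots> \<le> real (card (S \<inter> {a..<a + N})) + real (card (S \<inter> {a + N..<t + L}))"
      proof -
        have "t - (a + N) < t - a" using 3(1) N(1) by linarith
        from less[OF this] N(3) show ?thesis by (simp add: distrib_left)
      qed
      also have "\<dots> = real (card ((S \<inter> {a..<a + N}) \<union> (S \<inter> {a + N..<t + L})))"
        by (subst card_Un_disjoint) auto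
      also have "(S \<inter> {a..<a + N}) \<union> (S \<inter> {a + N..<t + L}) = S \<inter> {a..<t + L}"
        using 3 N by auto
      finally show ?thesis .
    qed
  qed
  moreover have "B \<inter> {a..<t} = {i\<in>{a..<t}. \<exists>N. 1 \<le> N \<and> N \<le> L \<and>
            \<beta> * real N \<le> real (card (S \<inter> {i..<i + N}))}"
    by (auto simp: B_def)
  ultimately show ?thesis by simp
qed

text \<open>
  If a bounded sequence has small averages over the blocks of length \<open>T\<close> that are not
  contained in \<open>S\<close>, then its sum over any interval is controlled by the length of the
  interval and by the number of points of \<open>S\<close> in it.
\<close>

lemma sum_le_by_blocks:
  fixes a :: "nat \<Rightarrow> real"
  assumes T: "0 < T" and M: "\<And>j. \<bar>a j\<bar> \<le> M" and \<alpha>: "0 \<le> \<alpha>"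
    and block: "\<And>k. \<not> {k * T..<k * T + T} \<subseteq> S \<Longrightarrow> \<bar>\<Sum>j\<in>{k * T..<k * T + T}. a j\<bar> \<le> \<alpha> * real T"
  shows "\<bar>\<Sum>j\<in>{i..<i + N}. a j\<bar>
    \<le> \<alpha> * real N + M * real (card (S \<inter> {i..<i + N})) + (3 * M + \<alpha>) * real T"
proof -
  have M0: "0 \<le> M" using M[of 0] abs_ge_zero[of "a 0"] by linarith
  \<comment> \<open>a majorant of the sequence on average over every block, whether contained in \<open>S\<close> or not\<close>
  define c where "c j = \<alpha> + M * indicat_real S j" for j
  have c0: "0 \<le> c j" and c1: "c j \<le> \<alpha> + M" for j
    using \<alpha> M0 by (auto simp: c_def indicator_def)
  have sum_c: "(\<Sum>j\<in>A. c j) = \<alpha> * real (card A) + M * real (card (S \<inter> A))" if "finite A" for A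
    using that by (simp add: c_def sum.distrib sum_distrib_left[symmetric] Int_commute
        sum_of_bool_eq indicator_def sum.If_cases flip: of_bool_def)
  have small: "\<bar>\<Sum>j\<in>{u..<v}. a j\<bar> \<le> M * real T" if "v - u \<le> T" for u v
  proof -
    have "\<bar>\<Sum>j\<in>{u..<v}. a j\<bar> \<le> (\<Sum>j\<in>{u..<v}. M)"
      by (rule order_trans[OF sum_abs sum_mono]) (rule M)
    also have "\<dots> \<le> M * real T"
      using that M0 by (simp add: mult.commute mult_left_mono)
    finally show ?thesis .
  qed
  have blocks: "\<bar>\<Sum>j\<in>{k * T..<k * T + T}. a j\<bar> \<le> (\<Sum>j\<in>{k * T..<k * T + T}. c j)" for k
  proof (cases "{k * T..<k * T + T} \<subseteq> S")
    case True
    then have "S \<inter> {k * T..<k * T + T} = {k * T..<k * T + T}" by blast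
    then show ?thesis using small[of "k * T + T" "k * T"] \<alpha> by (simp add: sum_c add_increasing)
  next
    case False
    then show ?thesis using block[OF False] M0 by (simp add: sum_c add_increasing2)
  qed
  have group: "(\<Sum>j\<in>{k * T..<l * T}. b j) = (\<Sum>m\<in>{k..<l}. \<Sum>j\<in>{m * T..<m * T + T}. b j)"
    if "k \<le> l" for k l and b :: "nat \<Rightarrow> real"
  proof -
    have "(\<Sum>j\<in>{k * T..<l * T}. b j) = (\<Sum>j\<in>{0..<l * T}. b j) - (\<Sum>j\<in>{0..<k * T}. b j)"
      using that by (subst sum_diff_nat_ivl) auto
    also have "\<dots> = (\<Sum>m\<in>{0..<l}. \<Sum>j\<in>{m * T..<m * T + T}. b j)
        - (\<Sum>m\<in>{0..<k}. \<Sum>j\<in>{m * T..<m * T + T}. b j)"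
      by (simp add: sum.nat_group atLeast0LessThan)
    also have "\<dots> = (\<Sum>m\<in>{k..<l}. \<Sum>j\<in>{m * T..<m * T + T}. b j)"
      using that by (subst sum_diff_nat_ivl) auto
    finally show ?thesis .
  qed
  define k l where "k = i div T" and "l = (i + N) div T"
  have kl: "k \<le> l" by (simp add: k_def l_def div_le_mono)
  have k: "k * T \<le> i" "i - k * T \<le> T" "i < k * T + T"
    using T mod_less_divisor[OF T, of i] div_mult_mod_eq[of i T]
    unfolding k_def by linarith+
  have l: "l * T \<le> i + N" "i + N - l * T \<le> T"
    using T mod_less_divisor[OF T, of "i + N"] div_mult_mod_eq[of "i + N" T]
    unfolding l_def by linarith+
  have klT: "k * T \<le> l * T" using kl by simp
  have main: "\<bar>\<Sum>j\<in>{k * T..<l * T}. a j\<bar> \<le> (\<Sum>j\<in>{k * T..<l * T}. c j)"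
    unfolding group[OF kl] by (rule order_trans[OF sum_abs sum_mono]) (rule blocks)
  have "(\<Sum>j\<in>{k * T..<l * T}. c j) \<le> (\<Sum>j\<in>{k * T..<i + N}. c j)"
    by (rule sum_mono2) (use l c0 in auto)
  also have "\<dots> = (\<Sum>j\<in>{k * T..<i}. c j) + (\<Sum>j\<in>{i..<i + N}. c j)"
    using k by (simp add: sum.atLeastLessThan_concat)
  also have "(\<Sum>j\<in>{k * T..<i}. c j) \<le> (\<Sum>j\<in>{k * T..<i}. \<alpha> + M)"
    by (rule sum_mono) (rule c1)
  also have "\<dots> \<le> (\<alpha> + M) * real T"
  proof -
    have "(\<alpha> + M) * real (i - k * T) \<le> (\<alpha> + M) * real T"
      using k(2) \<alpha> M0 by (intro mult_left_mono) auto
    then show ?thesis by (simp add: mult.commute)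
  qed
  finally have c: "(\<Sum>j\<in>{k * T..<l * T}. c j)
      \<le> (\<alpha> + M) * real T + (\<Sum>j\<in>{i..<i + N}. c j)" by simp
  have "(\<Sum>j\<in>{k * T..<i}. a j) + (\<Sum>j\<in>{i..<i + N}. a j) = (\<Sum>j\<in>{k * T..<i + N}. a j)"
    using k by (simp add: sum.atLeastLessThan_concat)
  also have "\<dots> = (\<Sum>j\<in>{k * T..<l * T}. a j) + (\<Sum>j\<in>{l * T..<i + N}. a j)"
    using klT l by (simp add: sum.atLeastLessThan_concat)
  finally have "\<bar>\<Sum>j\<in>{i..<i + N}. a j\<bar>
      \<le> \<bar>\<Sum>j\<in>{k * T..<l * T}. a j\<bar> + \<bar>\<Sum>j\<in>{l * T..<i + N}. a j\<bar> + \<bar>\<Sum>j\<in>{k * T..<i}. a j\<bar>"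
    by linarith
  also have "\<dots> \<le> (\<alpha> + M) * real T + (\<Sum>j\<in>{i..<i + N}. c j) + M * real T + M * real T"
    using main c small[OF k(2)] small[OF l(2)] by linarith
  finally show ?thesis by (simp add: sum_c algebra_simps)
qed

section \<open>Components and density of a sparse tail\<close>

lemma component_unique:
  assumes "is_component S I" "is_component S J" "i \<in> I" "i \<in> J"
  shows "I = J"
proof -
  obtain a b where I: "I = {a..b}" "I \<subseteq> S" "a = 0 \<or> a - 1 \<notin> S" "b + 1 \<notin> S"
    using assms(1) unfolding is_component_def by blast
  obtain c d where J: "J = {c..d}" "J \<subseteq> S" "c = 0 \<or> c - 1 \<notin> S" "d + 1 \<notin> S"
    using assms(2) unfolding is_component_def by blast
  have i: "a \<le> i" "i \<le> b" "c \<le> i" "i \<le> d" using assms I J by auto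
  have "\<not> a < c"
  proof
    assume "a < c"
    then have "c - 1 \<in> I" using i I by auto
    with I J \<open>a < c\<close> show False by auto
  qed
  moreover have "\<not> c < a"
  proof
    assume "c < a"
    then have "a - 1 \<in> J" using i J by auto
    with I J \<open>c < a\<close> show False by auto
  qed
  moreover have "\<not> b < d"
  proof
    assume "b < d"
    then have "b + 1 \<in> J" using i J by auto
    with I J show False by auto
  qed
  moreover have "\<not> d < b"
  proof
    assume "d < b"
    then have "d + 1 \<in> I" using i I by auto
    with I J show False by auto
  qed
  ultimately show ?thesis using I J by auto
qed

text \<open>
  A scale with a long sparse tail. The times in \<open>tail_level T R n\<close> are those in components of size
  exactly \<open>T n\<close>, the times in \<open>tail_from T R n\<close> those in components of size at least \<open>T n\<close>.
\<close>

locale sparse_tail =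
  fixes T :: "nat \<Rightarrow> nat" and \<epsilon> :: "nat \<Rightarrow> real" and R :: "nat set"
  assumes scale: "scale T"
    and controlling: "controlling_sequence \<epsilon>"
    and tail: "long_sparse_tail T \<epsilon> R"
begin

lemma T_pos: "0 < T n"
  using scale by (simp add: scale_def)

lemma T_Suc: "\<exists>c\<ge>3. T (Suc n) = c * T n"
proof -
  obtain \<kappa> :: "nat \<Rightarrow> nat" where "\<forall>n\<ge>1. \<kappa> n \<ge> 3 \<and> T n = \<kappa> n * T (n - 1)"
    using scale unfolding scale_def by blast
  then have "\<kappa> (Suc n) \<ge> 3 \<and> T (Suc n) = \<kappa> (Suc n) * T n" by (metis diff_Suc_1 le_add1 plus_1_eq_Suc)
  then show ?thesis by blast
qed

lemma T_less_Suc: "T n < T (Suc n)"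
proof -
  obtain c where "3 \<le> c" "T (Suc n) = c * T n" using T_Suc by blast
  then have "3 * T n \<le> T (Suc n)" by simp
  then show ?thesis using T_pos[of n] by linarith
qed

lemma T_strict_mono: "strict_mono T"
  by (simp add: strict_mono_Suc_iff T_less_Suc)

lemma T_dvd: "m \<le> n \<Longrightarrow> T m dvd T n"
proof (induction n rule: dec_induct)
  case (step n)
  with T_Suc[of n] show ?case by auto
qed simp

lemma scale_interval_eq: "scale_interval T n k = {k * T n..<k * T n + T n}"
  using T_pos[of n] by (auto simp: scale_interval_def)

lemma mem_scale_interval: "i \<in> scale_interval T n k \<longleftrightarrow> i div T n = k"
proof
  assume "i div T n = k"
  then show "i \<in> scale_interval T n k"
    using div_mult_mod_eq[of i "T n"] mod_less_divisor[OF T_pos[of n], of i]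
    unfolding scale_interval_eq by auto
next
  assume "i \<in> scale_interval T n k"
  then show "i div T n = k"
    using T_pos[of n] by (intro div_nat_eqI) (auto simp: scale_interval_eq mult.commute)
qed

lemma card_scale_interval: "card (scale_interval T n k) = T n"
  by (simp add: scale_interval_eq)

lemma scale_interval_nested:
  assumes "m \<le> n" "i \<in> scale_interval T m k" "i \<in> scale_interval T n l"
  shows "scale_interval T m k \<subseteq> scale_interval T n l"
proof -
  obtain c where c: "T n = T m * c" using T_dvd[OF assms(1)] by blast
  show ?thesis using assms(2,3) unfolding c subset_iff
    by (auto simp: mem_scale_interval c div_mult2_eq)
qed

lemma component_eq_scale_interval:
  assumes "is_component R C"
  obtains n k where "C = scale_interval T n k"
  using assms tail unfolding long_sparse_tail_def by blast

lemma mem_tail_level: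
  "i \<in> tail_level T R n \<longleftrightarrow> (\<exists>C. is_component R C \<and> card C = T n \<and> i \<in> C)"
  by (auto simp: tail_level_def)

lemma mem_tail_from:
  "i \<in> tail_from T R n \<longleftrightarrow> (\<exists>m\<ge>n. i \<in> tail_level T R m)"
  by (auto simp: tail_from_def)

lemma tail_outside_component:
  assumes "\<nexists>C. is_component R C \<and> scale_interval T (Suc n) k \<subseteq> C"
  shows "{k * T (Suc n)..k * T (Suc n) + T (Suc n) div 3} \<inter> tail_level T R n = {}"
    and "tail_level T R n \<inter> scale_interval T (Suc n) k \<noteq> {}"
    and "real (card (tail_level T R n \<inter> scale_interval T (Suc n) k)) \<le> \<epsilon> (Suc n) * real (T (Suc n))"
proof -
  let ?A = "tail_level T R n \<inter> scale_interval T (Suc n) k"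
  have *: "{k * T (Suc n)..k * T (Suc n) + T (Suc n) div 3} \<inter> tail_level T R n = {} \<and>
     0 < real (card ?A) / real (T (Suc n)) \<and> real (card ?A) / real (T (Suc n)) < \<epsilon> (Suc n)"
    using tail assms unfolding long_sparse_tail_def
    by (metis (no_types, lifting) diff_Suc_1 le_add1 plus_1_eq_Suc)
  then show "{k * T (Suc n)..k * T (Suc n) + T (Suc n) div 3} \<inter> tail_level T R n = {}" by blast
  from * show "?A \<noteq> {}" by auto
  from * show "real (card ?A) \<le> \<epsilon> (Suc n) * real (T (Suc n))"
    using T_pos[of "Suc n"] by (simp add: pos_divide_less_eq)
qed

lemma component_inside:
  assumes "\<nexists>C. is_component R C \<and> scale_interval T (Suc n) k \<subseteq> C"
  obtains C where "is_component R C" "card C = T n" "C \<subseteq> scale_interval T (Suc n) k"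
proof -
  obtain i C where i: "i \<in> scale_interval T (Suc n) k" and C: "is_component R C" "card C = T n" "i \<in> C"
    using tail_outside_component(2)[OF assms] by (auto simp: mem_tail_level)
  obtain m l where ml: "C = scale_interval T m l" using component_eq_scale_interval[OF C(1)] .
  then have "T m = T n" using C(2) by (simp add: card_scale_interval)
  then have "m = n" using T_strict_mono by (simp add: strict_mono_eq)
  then have "C \<subseteq> scale_interval T (Suc n) k"
    using C(3) i unfolding ml by (intro scale_interval_nested) auto
  with C show thesis using that by blast
qed

text \<open>
  Inside a component of size at least \<open>T (Suc n)\<close> there are no components of size \<open>T n\<close>, so that the
  frequency bound holds for all blocks.
\<close>

lemma card_tail_level_block:
  "real (card (tail_level T R n \<inter> scale_interval T (Suc n) k)) \<le> \<epsilon> (Suc n) * real (T (Suc n))"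
proof (cases "\<exists>C. is_component R C \<and> scale_interval T (Suc n) k \<subseteq> C")
  case False
  then show ?thesis by (rule tail_outside_component(3))
next
  case True
  then obtain C where C: "is_component R C" "scale_interval T (Suc n) k \<subseteq> C" by blast
  have "finite C" using C(1) unfolding is_component_def by auto
  then have "T (Suc n) \<le> card C" using card_mono[OF _ C(2)] by (simp add: card_scale_interval)
  then have card: "card C \<noteq> T n" using T_less_Suc[of n] by simp
  have "tail_level T R n \<inter> scale_interval T (Suc n) k = {}"
  proof (rule ccontr)
    assume "tail_level T R n \<inter> scale_interval T (Suc n) k \<noteq> {}"
    then obtain i C' where "i \<in> scale_interval T (Suc n) k" "is_component R C'" "card C' = T n" "i \<in> C'"
      by (auto simp: mem_tail_level)
    then show False using component_unique[OF C(1), of C' i] C(2) card by auto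
  qed
  moreover have "0 < \<epsilon> (Suc n)" using controlling by (simp add: controlling_sequence_def)
  ultimately show ?thesis by simp
qed

text \<open>
  The bound holds for all \<open>t\<close>, without a lower bound in terms of the scale: initial segments
  that are too short to be compared with blocks of length \<open>T (Suc n)\<close> do not meet the
  components of size \<open>T n\<close>, because the first block starts with \<open>0\<close>, which is not in \<open>R\<close>.
\<close>

lemma card_tail_level_le:
  "real (card (tail_level T R n \<inter> {..<t})) \<le> 4 * \<epsilon> (Suc n) * real t"
proof (cases "t \<le> T (Suc n) div 3")
  case True
  have "0 \<in> scale_interval T (Suc n) 0" by (simp add: mem_scale_interval)
  moreover have "0 \<notin> R" using tail by (simp add: long_sparse_tail_def)
  ultimately have "\<nexists>C. is_component R C \<and> scale_interval T (Suc n) 0 \<subseteq> C"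
    unfolding is_component_def by blast
  from tail_outside_component(1)[OF this] True have "tail_level T R n \<inter> {..<t} = {}"
    by (fastforce simp: disjoint_iff)
  moreover have "0 < \<epsilon> (Suc n)" using controlling by (simp add: controlling_sequence_def)
  ultimately show ?thesis by simp
next
  case False
  define U where "U = T (Suc n)"
  have e: "0 < \<epsilon> (Suc n)" using controlling by (simp add: controlling_sequence_def)
  have "tail_level T R n \<inter> {..<t}
      \<subseteq> (\<Union>k\<in>{..t div U}. tail_level T R n \<inter> scale_interval T (Suc n) k)"
    by (auto simp: mem_scale_interval U_def intro!: div_le_mono)
  then have "card (tail_level T R n \<inter> {..<t})
      \<le> card (\<Union>k\<in>{..t div U}. tail_level T R n \<inter> scale_interval T (Suc n) k)"
    by (intro card_mono) (auto simp: scale_interval_def)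
  also have "\<dots> \<le> (\<Sum>k\<in>{..t div U}. card (tail_level T R n \<inter> scale_interval T (Suc n) k))"
    by (rule card_UN_le) simp
  finally have "real (card (tail_level T R n \<inter> {..<t}))
      \<le> (\<Sum>k\<in>{..t div U}. real (card (tail_level T R n \<inter> scale_interval T (Suc n) k)))"
    by (metis of_nat_le_iff of_nat_sum)
  also have "\<dots> \<le> (\<Sum>k\<in>{..t div U}. \<epsilon> (Suc n) * real U)"
    unfolding U_def by (rule sum_mono) (rule card_tail_level_block)
  also have "\<dots> = \<epsilon> (Suc n) * real (Suc (t div U) * U)" by (simp add: algebra_simps)
  also have "\<dots> \<le> \<epsilon> (Suc n) * real (4 * t)"
  proof -
    have "t div U * U \<le> t" by (rule div_times_less_eq_dividend)
    moreover have "U \<le> 3 * t" using False unfolding U_def by linarith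
    ultimately have "Suc (t div U) * U \<le> 4 * t" by (simp only: mult_Suc)
    then show ?thesis using e by (intro mult_left_mono) (auto simp del: of_nat_mult mult_Suc)
  qed
  finally show ?thesis by (simp add: mult_ac)
qed

text \<open>
  An upper bound, uniform over all initial segments of times, for the proportion of times in
  components of size at least \<open>T p\<close>.
\<close>

definition tail_density :: "nat \<Rightarrow> real" where
  "tail_density p = 4 * (\<Sum>n. \<epsilon> (n + Suc p))"

lemma tail_density_tendsto: "tail_density \<longlonglongrightarrow> 0"
proof -
  have "summable \<epsilon>" using controlling by (simp add: controlling_sequence_def)
  then have "(\<lambda>p. \<Sum>n. \<epsilon> (n + p)) \<longlonglongrightarrow> 0" by (rule suminf_exist_split2)
  then have "(\<lambda>p. 4 * (\<Sum>n. \<epsilon> (n + Suc p))) \<longlonglongrightarrow> 4 * 0"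
    by (intro tendsto_mult tendsto_const LIMSEQ_Suc)
  then show ?thesis unfolding tail_density_def by simp
qed

lemma card_tail_from_le:
  "real (card (tail_from T R p \<inter> {..<t})) \<le> tail_density p * real t"
proof -
  have pos: "0 < \<epsilon> n" for n using controlling by (simp add: controlling_sequence_def)
  have summ: "summable (\<lambda>n. \<epsilon> (n + Suc p))"
    using controlling by (intro summable_ignore_initial_segment) (simp add: controlling_sequence_def)
  have "tail_from T R p \<inter> {..<t} \<subseteq> (\<Union>n\<in>{..<t}. tail_level T R (n + p) \<inter> {..<t})"
  proof
    fix i assume i: "i \<in> tail_from T R p \<inter> {..<t}"
    then obtain m where m: "p \<le> m" "i \<in> tail_level T R m" by (auto simp: mem_tail_from)
    \<comment> \<open>a component of size \<open>T m\<close> is an interval that starts at a positive multiple of \<open>T m\<close>\<close>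
    obtain C where C: "is_component R C" "card C = T m" "i \<in> C" using m by (auto simp: mem_tail_level)
    obtain n k where nk: "C = scale_interval T n k" using component_eq_scale_interval[OF C(1)] .
    have "T n = T m" using C(2) by (simp add: nk card_scale_interval)
    then have n: "n = m" using T_strict_mono by (simp add: strict_mono_eq)
    have "0 \<notin> C" using C(1) tail unfolding is_component_def long_sparse_tail_def by blast
    then have "k \<noteq> 0" by (auto simp: nk mem_scale_interval)
    then have "T m \<le> i" using C(3) by (auto simp: nk n scale_interval_eq intro: order_trans[rotated])
    moreover have "m \<le> T m" by (rule strict_mono_imp_increasing[OF T_strict_mono])
    ultimately have "m < t" using i by auto
    then show "i \<in> (\<Union>n\<in>{..<t}. tail_level T R (n + p) \<inter> {..<t})"
      using m i by (auto intro!: bexI[of _ "m - p"])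
  qed
  then have "card (tail_from T R p \<inter> {..<t})
      \<le> card (\<Union>n\<in>{..<t}. tail_level T R (n + p) \<inter> {..<t})"
    by (intro card_mono) auto
  also have "\<dots> \<le> (\<Sum>n<t. card (tail_level T R (n + p) \<inter> {..<t}))"
    by (rule card_UN_le) simp
  finally have "real (card (tail_from T R p \<inter> {..<t}))
      \<le> (\<Sum>n<t. real (card (tail_level T R (n + p) \<inter> {..<t})))"
    by (metis of_nat_le_iff of_nat_sum)
  also have "\<dots> \<le> (\<Sum>n<t. 4 * \<epsilon> (Suc (n + p)) * real t)"
    by (rule sum_mono) (rule card_tail_level_le)
  also have "\<dots> = 4 * (\<Sum>n<t. \<epsilon> (n + Suc p)) * real t"
    by (simp add: sum_distrib_left sum_distrib_right)
  also have "\<dots> \<le> 4 * (\<Sum>n. \<epsilon> (n + Suc p)) * real t"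
    using sum_le_suminf[OF summ, of "{..<t}"] pos
    by (intro mult_right_mono mult_left_mono) (auto simp: less_imp_le)
  finally show ?thesis by (simp add: tail_density_def)
qed

text \<open>
  If the time \<open>i + T (Suc n)\<close> is not in a component of size at least \<open>T p\<close>, then the window
  of times below contains a component of size \<open>T n\<close>: either the block of length \<open>T (Suc n)\<close>
  around that time is not contained in a component, or it lies in a component of size less
  than \<open>T p\<close>, and then the block right after this component is not contained in any.
\<close>

lemma component_in_window:
  assumes notin: "i + T (Suc n) \<notin> tail_from T R p"
  obtains C where "is_component R C" "card C = T n" "C \<subseteq> {i..i + 2 * T (Suc n) + T p}"
proof -
  define U where "U = T (Suc n)"
  define s where "s = i + U"
  define k where "k = s div U"
  have U: "0 < U" unfolding U_def by (rule T_pos)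
  have s: "s \<in> scale_interval T (Suc n) k" by (simp add: mem_scale_interval k_def U_def)
  show thesis
  proof (cases "\<exists>C. is_component R C \<and> scale_interval T (Suc n) k \<subseteq> C")
    case False
    then obtain C where C: "is_component R C" "card C = T n" "C \<subseteq> scale_interval T (Suc n) k"
      by (rule component_inside)
    have "scale_interval T (Suc n) k \<subseteq> {i..i + 2 * T (Suc n) + T p}"
      using s unfolding scale_interval_eq s_def U_def by auto
    with C show thesis using that by blast
  next
    case True
    then obtain C where C: "is_component R C" "scale_interval T (Suc n) k \<subseteq> C" by blast
    obtain q l where ql: "C = scale_interval T q l" using component_eq_scale_interval[OF C(1)] .
    have sC: "s \<in> C" using C s by blast
    have "\<not> p \<le> q"
    proof
      assume "p \<le> q"
      then have "s \<in> tail_from T R p"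
        using C(1) sC card_scale_interval unfolding ql mem_tail_from mem_tail_level by blast
      with notin show False by (simp add: s_def U_def)
    qed
    then have Tq: "T q \<le> T p" using T_strict_mono by (simp add: strict_mono_less_eq)
    have "T (Suc n) \<le> T q"
      using card_mono[OF _ C(2)] unfolding ql card_scale_interval
      by (simp add: scale_interval_def)
    then have "Suc n \<le> q" using T_strict_mono by (simp add: strict_mono_less_eq)
    then obtain c where c: "T q = T (Suc n) * c" using T_dvd by blast
    \<comment> \<open>the first time after \<open>C\<close>; it is not in \<open>R\<close> and starts a block of length \<open>T (Suc n)\<close>\<close>
    define e where "e = l * T q + T q"
    have e_eq: "e = (l * c + c) * T (Suc n)" by (simp add: e_def c algebra_simps)
    have e_in: "e \<in> scale_interval T (Suc n) (l * c + c)"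
      unfolding e_eq scale_interval_eq using T_pos[of "Suc n"] by simp
    have "e \<notin> R"
    proof -
      obtain a b where ab: "a \<le> b" "C = {a..b}" "b + 1 \<notin> R"
        using C(1) unfolding is_component_def by blast
      have "C = {l * T q..e - 1}"
        using T_pos[of q] unfolding ql scale_interval_eq e_def by auto
      then have "{a..b} = {l * T q..e - 1}" using ab by simp
      then have "b = e - 1" using ab(1) by simp
      moreover have "0 < e" using T_pos[of q] by (simp add: e_def)
      ultimately show ?thesis using ab(3) by simp
    qed
    then have "\<nexists>C. is_component R C \<and> scale_interval T (Suc n) (l * c + c) \<subseteq> C"
      using e_in unfolding is_component_def by blast
    then obtain C' where C': "is_component R C'" "card C' = T n"
      "C' \<subseteq> scale_interval T (Suc n) (l * c + c)"
      by (rule component_inside)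
    have "s < e" "e \<le> s + T p"
      using sC Tq unfolding ql scale_interval_eq e_def by auto
    then have "scale_interval T (Suc n) (l * c + c) \<subseteq> {i..i + 2 * T (Suc n) + T p}"
      unfolding scale_interval_eq e_eq[symmetric] s_def U_def by auto
    with C' show thesis using that by blast
  qed
qed

end

section \<open>Typical points of the limit measure\<close>

lemma continuous_on_funpow:
  assumes "continuous_on UNIV (f :: 'a::topological_space \<Rightarrow> 'a)"
  shows "continuous_on UNIV (f ^^ n)"
proof (induction n)
  case (Suc n)
  then show ?case
    using continuous_on_compose[of UNIV "f ^^ n" f] assms
    by (auto intro: continuous_on_subset)
qed (simp add: id_def)

lemma continuous_on_birkhoff_average:
  assumes "continuous_on UNIV f" "continuous_on UNIV \<phi>"
  shows "continuous_on UNIV (birkhoff_average f \<phi> n)"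
proof -
  have "continuous_on UNIV (\<lambda>x. \<phi> ((f ^^ i) x))" for i
    using continuous_on_compose[OF continuous_on_funpow[OF assms(1)], of i \<phi>] assms(2)
    by (auto simp: comp_def intro: continuous_on_subset)
  then show ?thesis
    unfolding birkhoff_average_def divide_inverse by (intro continuous_intros)
qed

context sparse_tail
begin

lemma AE_dense_orbit:
  fixes f :: "'a::metric_space \<Rightarrow> 'a"
  assumes f: "continuous_on UNIV f"
    and lim: "weak_star_limit_of_subsequence (\<lambda>n. empirical_measure f n x) \<mu>"
    and \<delta>: "\<delta> \<longlonglongrightarrow> 0"
    and dense: "\<And>n I. is_component R I \<Longrightarrow> card I = T n \<Longrightarrow>
      delta_dense (\<delta> n) ((\<lambda>i. (f ^^ i) x) ` I) Y"
  shows "AE z in \<mu>. dense_in (forward_orbit f z) Y"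
proof -
  have prob: "prob_space \<mu>" and sets: "sets \<mu> = sets borel"
    using lim by (auto simp: weak_star_limit_of_subsequence_def)
  have "AE z in \<mu>. \<forall>y\<in>Y. \<exists>j. dist ((f ^^ j) z) y \<le> \<delta> n" for n
  proof (rule AE_of_large_closed_sets[OF prob sets])
    fix e :: real assume "0 < e"
    then obtain p where p: "tail_density p < e"
      using order_tendstoD(2)[OF tail_density_tendsto] by (auto simp: eventually_sequentially)
    \<comment> \<open>the length of the window in which a component of size \<open>T n\<close> is found\<close>
    define L where "L = 2 * T (Suc n) + T p"
    define K where "K = (\<Inter>y\<in>Y. \<Union>j\<in>{..L}. {z. dist ((f ^^ j) z) y \<le> \<delta> n})"
    have "closed K"
      unfolding K_def
      by (intro closed_INT ballI closed_UN finite_atMost closed_Collect_le continuous_intros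
          continuous_on_funpow[OF f])
    moreover have "1 - tail_density p \<le> measure \<mu> K"
    proof (rule weak_star_limit_closed[OF lim \<open>closed K\<close>])
      fix t
      have in_K: "(f ^^ i) x \<in> K" if "i + T (Suc n) \<notin> tail_from T R p" for i
      proof -
        obtain C where C: "is_component R C" "card C = T n" "C \<subseteq> {i..i + L}"
          using component_in_window[OF \<open>i + T (Suc n) \<notin> tail_from T R p\<close>]
          unfolding L_def by (metis add.assoc)
        have "\<exists>j\<le>L. dist ((f ^^ j) ((f ^^ i) x)) y \<le> \<delta> n" if y: "y \<in> Y" for y
        proof -
          obtain m where m: "m \<in> C" "dist ((f ^^ m) x) y < \<delta> n"
            using dense[OF C(1,2)] y by (fastforce simp: delta_dense_def)
          then have "i \<le> m" "m - i \<le> L" using C(3) by (auto simp: subset_iff)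
          then show ?thesis
            using m(2) by (intro exI[of _ "m - i"]) (simp flip: funpow_add[THEN fun_cong, unfolded comp_def])
        qed
        then show ?thesis by (auto simp: K_def)
      qed
      let ?U = "T (Suc n)"
      let ?B = "{i. i < t \<and> i + ?U \<in> tail_from T R p}"
      have "card ?B = card ((\<lambda>i. i + ?U) ` ?B)"
        by (intro card_image[symmetric]) (simp add: inj_on_def)
      also have "\<dots> \<le> card (tail_from T R p \<inter> {..<t + ?U})"
        by (intro card_mono) auto
      finally have B: "real (card ?B) \<le> tail_density p * real (t + ?U)"
        using card_tail_from_le[of p "t + ?U"] by linarith
      have "{..<t} \<subseteq> {i. i < t \<and> (f ^^ i) x \<in> K} \<union> ?B" using in_K by auto
      then have "card {..<t} \<le> card ({i. i < t \<and> (f ^^ i) x \<in> K} \<union> ?B)"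
        by (intro card_mono) auto
      also have "\<dots> \<le> card {i. i < t \<and> (f ^^ i) x \<in> K} + card ?B" by (rule card_Un_le)
      finally have "real t \<le> real (card {i. i < t \<and> (f ^^ i) x \<in> K}) + real (card ?B)" by simp
      with B show "(1 - tail_density p) * real t - tail_density p * real ?U
          \<le> real (card {i. i < t \<and> (f ^^ i) x \<in> K})"
        by (simp add: algebra_simps)
    qed
    ultimately show "\<exists>K. closed K \<and> 1 - e \<le> measure \<mu> K \<and>
        (\<forall>z\<in>K. \<forall>y\<in>Y. \<exists>j. dist ((f ^^ j) z) y \<le> \<delta> n)"
      using p by (intro exI[of _ K]) (auto simp: K_def)
  qed
  then have "AE z in \<mu>. \<forall>n. \<forall>y\<in>Y. \<exists>j. dist ((f ^^ j) z) y \<le> \<delta> n"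
    by (simp add: AE_all_countable)
  then show ?thesis
  proof (rule AE_mp, intro AE_I2 impI)
    fix z assume z: "\<forall>n. \<forall>y\<in>Y. \<exists>j. dist ((f ^^ j) z) y \<le> \<delta> n"
    show "dense_in (forward_orbit f z) Y"
      unfolding dense_in_def
    proof
      fix y assume y: "y \<in> Y"
      show "y \<in> closure (forward_orbit f z)"
        unfolding closure_approachable
      proof (intro allI impI)
        fix e :: real assume "0 < e"
        then obtain n where "\<delta> n < e"
          using order_tendstoD(2)[OF \<delta>] by (auto simp: eventually_sequentially)
        moreover obtain j where "dist ((f ^^ j) z) y \<le> \<delta> n" using z y by blast
        ultimately have "dist ((f ^^ j) z) y < e" by linarith
        then show "\<exists>w\<in>forward_orbit f z. dist w y < e"
          by (auto simp: forward_orbit_def)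
      qed
    qed
  qed
qed

text \<open>
  The exceptional set is controlled by the maximal inequality applied to the long components,
  which replaces the ergodic theorem.
\<close>

lemma AE_birkhoff_average:
  fixes f :: "'a::metric_space \<Rightarrow> 'a"
  assumes f: "continuous_on UNIV f" and \<phi>: "continuous_on UNIV \<phi>"
    and M: "\<And>z. \<bar>\<phi> z\<bar> \<le> M"
    and lim: "weak_star_limit_of_subsequence (\<lambda>n. empirical_measure f n x) \<mu>"
    and \<alpha>: "\<alpha> \<longlonglongrightarrow> 0" and \<alpha>_pos: "\<And>n. 0 < \<alpha> n"
    and average: "\<And>n k. \<not> scale_interval T n k \<subseteq> tail_from T R (n + 1) \<Longrightarrow>
      (\<Sum>i\<in>scale_interval T n k. \<phi> ((f ^^ i) x)) / real (T n) \<in> {- \<alpha> n .. \<alpha> n}"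
  shows "AE z in \<mu>. (\<lambda>n. birkhoff_average f \<phi> n z) \<longlonglongrightarrow> 0"
proof -
  have prob: "prob_space \<mu>" and sets: "sets \<mu> = sets borel"
    using lim by (auto simp: weak_star_limit_of_subsequence_def)
  interpret prob_space \<mu> by fact
  have M0: "0 \<le> M" using M[of undefined] by linarith
  have close: "AE z in \<mu>. \<exists>N0. \<forall>N\<ge>N0. \<bar>birkhoff_average f \<phi> N z\<bar> \<le> \<gamma>" if \<gamma>: "0 < \<gamma>" for \<gamma>
  proof (rule AE_of_large_closed_sets[OF prob sets])
    fix e :: real assume e: "0 < e"
    \<comment> \<open>the error in the average over \<open>N\<close> times has three parts, each to be made at most \<open>\<gamma> / 3\<close>: the
      averages over good blocks, the frequency of long components, and the incomplete blocks at
      the two ends; \<open>\<beta>\<close> is the threshold for the frequency, with \<open>M + 1\<close> in case \<open>M = 0\<close>\<close>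
    define \<beta> where "\<beta> = \<gamma> / (3 * (M + 1))"
    have \<beta>: "0 < \<beta>" "M * \<beta> \<le> \<gamma> / 3"
      using \<gamma> M0 by (auto simp: \<beta>_def field_simps)
    have "\<forall>\<^sub>F n in sequentially. tail_density (n + 1) < e * \<beta> \<and> \<alpha> n < \<gamma> / 3"
      using order_tendstoD(2)[OF LIMSEQ_Suc[OF tail_density_tendsto], of "e * \<beta>"]
        order_tendstoD(2)[OF \<alpha>, of "\<gamma> / 3"] e \<beta> \<gamma>
      by (auto simp: eventually_conj_iff)
    then obtain n where n: "tail_density (n + 1) < e * \<beta>" "\<alpha> n < \<gamma> / 3"
      by (auto simp: eventually_sequentially)
    define S where "S = tail_from T R (n + 1)"
    define a where "a j = \<phi> ((f ^^ j) x)" for j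
    obtain N0 :: nat where N0: "(3 * M + \<alpha> n) * real (T n) < real N0 * (\<gamma> / 3)"
      using reals_Archimedean3[of "\<gamma> / 3"] \<gamma> by auto
    have sum_a: "\<bar>\<Sum>j\<in>{i..<i + N}. a j\<bar>
        \<le> \<alpha> n * real N + M * real (card (S \<inter> {i..<i + N})) + (3 * M + \<alpha> n) * real (T n)" for i N
    proof (rule sum_le_by_blocks[OF T_pos])
      show "\<bar>a j\<bar> \<le> M" for j by (simp add: a_def M)
      show "0 \<le> \<alpha> n" using \<alpha>_pos[of n] by simp
      show "\<bar>\<Sum>j\<in>{k * T n..<k * T n + T n}. a j\<bar> \<le> \<alpha> n * real (T n)"
        if "\<not> {k * T n..<k * T n + T n} \<subseteq> S" for k
        using average[of n k] that T_pos[of n]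
        by (auto simp: S_def a_def scale_interval_eq abs_le_iff field_simps)
    qed
    have shift: "birkhoff_average f \<phi> N ((f ^^ i) x) = (\<Sum>j\<in>{i..<i + N}. a j) / real N" for i N
    proof -
      have "(\<Sum>j\<in>{0 + i..<N + i}. a j) = (\<Sum>j\<in>{0..<N}. a (j + i))"
        by (rule sum.shift_bounds_nat_ivl)
      then show ?thesis
        by (simp add: birkhoff_average_def a_def funpow_add atLeast0LessThan add.commute[of i N])
    qed
    \<comment> \<open>the bound \<open>L\<close> is needed because the maximal inequality overshoots \<open>t\<close> by up to \<open>L\<close>; for fixed \<open>L\<close>
      this is negligible as \<open>t\<close> tends to infinity\<close>
    define K where "K L = {z. \<forall>N\<in>{Suc N0..L}. \<bar>birkhoff_average f \<phi> N z\<bar> \<le> \<gamma>}" for L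
    have closed: "closed (K L)" for L
    proof -
      have "K L = (\<Inter>N\<in>{Suc N0..L}. {z. \<bar>birkhoff_average f \<phi> N z\<bar> \<le> \<gamma>})"
        by (auto simp: K_def)
      then show ?thesis
        by (simp only:)
          (intro closed_INT ballI closed_Collect_le continuous_intros
            continuous_on_birkhoff_average[OF f \<phi>])
    qed
    have K: "1 - e \<le> measure \<mu> (K L)" for L
    proof (rule weak_star_limit_closed[OF lim closed])
      fix t
      let ?B = "{i\<in>{0..<t}. \<exists>N. 1 \<le> N \<and> N \<le> L \<and> \<beta> * real N \<le> real (card (S \<inter> {i..<i + N}))}"
      have in_K: "(f ^^ i) x \<in> K L" if "i < t" "i \<notin> ?B" for i
        unfolding K_def
      proof (intro CollectI ballI)
        fix N assume N: "N \<in> {Suc N0..L}"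
        then have "real (card (S \<inter> {i..<i + N})) < \<beta> * real N"
          using that by (auto simp: not_le dest!: spec[of _ N])
        then have "M * real (card (S \<inter> {i..<i + N})) \<le> M * (\<beta> * real N)"
          using M0 by (intro mult_left_mono) auto
        also have "\<dots> \<le> \<gamma> / 3 * real N"
          using mult_right_mono[OF \<beta>(2), of "real N"] by (simp add: mult.assoc)
        finally have 1: "M * real (card (S \<inter> {i..<i + N})) \<le> \<gamma> / 3 * real N" .
        have 2: "\<alpha> n * real N \<le> \<gamma> / 3 * real N"
          using n(2) by (intro mult_right_mono) auto
        have "real N0 * (\<gamma> / 3) \<le> \<gamma> / 3 * real N"
          using N \<gamma> by simp
        with N0 have 3: "(3 * M + \<alpha> n) * real (T n) \<le> \<gamma> / 3 * real N" by linarith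
        have "\<bar>\<Sum>j\<in>{i..<i + N}. a j\<bar> \<le> \<gamma> / 3 * real N + \<gamma> / 3 * real N + \<gamma> / 3 * real N"
          using sum_a[of i N] 1 2 3 by linarith
        also have "\<dots> = \<gamma> * real N" by simp
        finally show "\<bar>birkhoff_average f \<phi> N ((f ^^ i) x)\<bar> \<le> \<gamma>"
          using N by (simp add: shift abs_divide divide_le_eq)
      qed
      have "\<beta> * real (card ?B) \<le> real (card (S \<inter> {0..<t + L}))"
        by (rule discrete_maximal_inequality) (use \<beta> in simp)
      also have "\<dots> \<le> tail_density (n + 1) * real (t + L)"
        using card_tail_from_le[of "n + 1" "t + L"] by (simp add: S_def atLeast0LessThan)
      also have "\<dots> \<le> e * \<beta> * real (t + L)"
        using n(1) by (intro mult_right_mono) auto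
      finally have "\<beta> * real (card ?B) \<le> \<beta> * (e * real (t + L))" by (simp add: mult_ac)
      then have B: "real (card ?B) \<le> e * real (t + L)" using \<beta>(1) by simp
      have "{..<t} \<subseteq> {i. i < t \<and> (f ^^ i) x \<in> K L} \<union> ?B" using in_K by blast
      then have "card {..<t} \<le> card ({i. i < t \<and> (f ^^ i) x \<in> K L} \<union> ?B)"
        by (intro card_mono) auto
      also have "\<dots> \<le> card {i. i < t \<and> (f ^^ i) x \<in> K L} + card ?B" by (rule card_Un_le)
      finally have "real t \<le> real (card {i. i < t \<and> (f ^^ i) x \<in> K L}) + real (card ?B)" by simp
      with B show "(1 - e) * real t - e * real L \<le> real (card {i. i < t \<and> (f ^^ i) x \<in> K L})"
        by (simp add: algebra_simps)
    qed
    have "(\<lambda>L. measure \<mu> (K L)) \<longlonglongrightarrow> measure \<mu> (\<Inter>L. K L)"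
    proof (rule finite_Lim_measure_decseq)
      show "range K \<subseteq> events" using closed sets by auto
      show "decseq K" by (auto simp: decseq_def K_def)
    qed
    then have "1 - e \<le> measure \<mu> (\<Inter>L. K L)"
      using K by (auto intro: LIMSEQ_le_const)
    moreover have "\<forall>z\<in>(\<Inter>L. K L). \<exists>N0. \<forall>N\<ge>N0. \<bar>birkhoff_average f \<phi> N z\<bar> \<le> \<gamma>"
    proof (intro ballI exI[of _ "Suc N0"] allI impI)
      fix z N assume "z \<in> (\<Inter>L. K L)" "Suc N0 \<le> N"
      then have "z \<in> K N" "N \<in> {Suc N0..N}" by auto
      then show "\<bar>birkhoff_average f \<phi> N z\<bar> \<le> \<gamma>" unfolding K_def by blast
    qed
    ultimately show "\<exists>K. closed K \<and> 1 - e \<le> measure \<mu> K \<and>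
        (\<forall>z\<in>K. \<exists>N0. \<forall>N\<ge>N0. \<bar>birkhoff_average f \<phi> N z\<bar> \<le> \<gamma>)"
      using closed by (intro exI[of _ "\<Inter>L. K L"]) auto
  qed
  have "AE z in \<mu>. \<forall>m. \<exists>N0. \<forall>N\<ge>N0. \<bar>birkhoff_average f \<phi> N z\<bar> \<le> 1 / real (Suc m)"
    using close by (simp add: AE_all_countable)
  then show ?thesis
  proof (rule AE_mp, intro AE_I2 impI)
    fix z assume z: "\<forall>m. \<exists>N0. \<forall>N\<ge>N0. \<bar>birkhoff_average f \<phi> N z\<bar> \<le> 1 / real (Suc m)"
    show "(\<lambda>n. birkhoff_average f \<phi> n z) \<longlonglongrightarrow> 0"
    proof (rule LIMSEQ_I)
      fix r :: real assume "0 < r"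
      then obtain m where m: "1 / real (Suc m) < r" using nat_approx_posE by blast
      obtain N0 where "\<forall>N\<ge>N0. \<bar>birkhoff_average f \<phi> N z\<bar> \<le> 1 / real (Suc m)" using z by blast
      then show "\<exists>no. \<forall>n\<ge>no. norm (birkhoff_average f \<phi> n z - 0) < r"
        using m by (intro exI[of _ N0]) fastforce
    qed
  qed
qed

end

section \<open>Invariant measures and the ergodic decomposition\<close>

lemma AE_ergodic_component:
  assumes P: "ergodic_decomposition f \<mu> P" and sets: "sets \<mu> = sets borel"
    and Q: "AE x in \<mu>. Q x"
  shows "AE \<nu> in P. AE x in \<nu>. Q x"
proof -
  have setsP: "sets P = sets (prob_algebra borel)" and erg: "AE \<nu> in P. ergodic_prob f \<nu>"
    and bary: "\<And>A. A \<in> sets borel \<Longrightarrow> emeasure \<mu> A = (\<integral>\<^sup>+ \<nu>. emeasure \<nu> A \<partial>P)"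
    using P by (auto simp: ergodic_decomposition_def)
  obtain N where N: "N \<in> null_sets \<mu>" "{x \<in> space \<mu>. \<not> Q x} \<subseteq> N"
    using Q by (auto simp: eventually_ae_filter)
  then have Nb: "N \<in> sets borel" and N0: "emeasure \<mu> N = 0" using sets by auto
  have meas: "(\<lambda>\<nu>. emeasure \<nu> N) \<in> borel_measurable P"
    using measurable_prob_algebraD[OF measurable_ident_sets[OF setsP]]
      measurable_emeasure_subprob_algebra[OF Nb]
    by (rule measurable_compose[unfolded id_def])
  have "AE \<nu> in P. emeasure \<nu> N = 0"
    using bary[OF Nb] N0 nn_integral_0_iff_AE[OF meas] by simp
  with erg show ?thesis
  proof eventually_elim
    case (elim \<nu>)
    then have s: "sets \<nu> = sets borel" by (simp add: ergodic_prob_def invariant_prob_def)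
    have "N \<in> null_sets \<nu>" using elim s Nb by auto
    moreover have "{x \<in> space \<nu>. \<not> Q x} \<subseteq> N"
      using N(2) sets_eq_imp_space_eq[OF s] sets_eq_imp_space_eq[OF sets] by simp
    ultimately show ?case by (rule AE_I')
  qed
qed

lemma integral_funpow_invariant:
  assumes f: "continuous_on UNIV f" and \<nu>: "invariant_prob f \<nu>"
    and \<phi>: "(\<phi> :: 'a::topological_space \<Rightarrow> real) \<in> borel_measurable borel"
  shows "integral\<^sup>L \<nu> (\<lambda>x. \<phi> ((f ^^ i) x)) = integral\<^sup>L \<nu> \<phi>"
proof -
  have s: "sets \<nu> = sets borel" using \<nu> by (simp add: invariant_prob_def)
  have fm: "f \<in> borel_measurable borel" using f by (rule borel_measurable_continuous_onI)
  then have fm': "f \<in> \<nu> \<rightarrow>\<^sub>M borel" by (simp add: measurable_cong_sets[OF s refl])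
  have distr: "distr \<nu> borel f = \<nu>"
  proof (rule measure_eqI)
    show "emeasure (distr \<nu> borel f) A = emeasure \<nu> A" if "A \<in> sets (distr \<nu> borel f)" for A
      using that \<nu> fm' sets_eq_imp_space_eq[OF s]
      by (simp add: emeasure_distr invariant_prob_def)
  qed (simp add: s)
  have step: "integral\<^sup>L \<nu> (\<lambda>x. h (f x)) = integral\<^sup>L \<nu> h"
    if "h \<in> borel_measurable borel" for h :: "'a \<Rightarrow> real"
    using integral_distr[OF fm' that] by (simp add: distr)
  show ?thesis
  proof (induction i)
    case (Suc i)
    have "(\<lambda>x. \<phi> ((f ^^ i) x)) \<in> borel_measurable borel"
      using measurable_compose[OF borel_measurable_continuous_onI[OF continuous_on_funpow[OF f]] \<phi>] .
    from step[OF this] Suc show ?case by (simp add: funpow_swap1)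
  qed simp
qed

lemma integral_eq_0_of_birkhoff_average:
  assumes f: "continuous_on UNIV f" and \<phi>: "continuous_on UNIV \<phi>"
    and M: "\<And>z. \<bar>\<phi> z\<bar> \<le> M" and \<nu>: "invariant_prob f \<nu>"
    and AE: "AE z in \<nu>. (\<lambda>n. birkhoff_average f \<phi> n z) \<longlonglongrightarrow> 0"
  shows "integral\<^sup>L \<nu> \<phi> = 0"
proof -
  have s: "sets \<nu> = sets borel" and "prob_space \<nu>" using \<nu> by (auto simp: invariant_prob_def)
  interpret prob_space \<nu> by fact
  have M0: "0 \<le> M" using M[of undefined] by linarith
  have \<phi>m: "\<phi> \<in> borel_measurable borel" using \<phi> by (rule borel_measurable_continuous_onI)
  have im: "(\<lambda>x. \<phi> ((f ^^ i) x)) \<in> borel_measurable \<nu>" for i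
    using measurable_compose[OF borel_measurable_continuous_onI[OF continuous_on_funpow[OF f]] \<phi>m]
    by (simp add: measurable_cong_sets[OF s refl])
  have int: "integrable \<nu> (\<lambda>x. \<phi> ((f ^^ i) x))" for i
    by (rule integrable_const_bound[of _ M]) (use im M in auto)
  have avg: "integral\<^sup>L \<nu> (birkhoff_average f \<phi> (Suc n)) = integral\<^sup>L \<nu> \<phi>" for n
  proof -
    have "integral\<^sup>L \<nu> (birkhoff_average f \<phi> (Suc n))
        = (\<Sum>i<Suc n. integral\<^sup>L \<nu> (\<lambda>x. \<phi> ((f ^^ i) x))) / real (Suc n)"
      unfolding birkhoff_average_def[abs_def] using int
      by (simp only: integral_divide_zero Bochner_Integration.integral_sum)
    also have "\<dots> = integral\<^sup>L \<nu> \<phi>"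
      by (simp only: integral_funpow_invariant[OF f \<nu> \<phi>m]) (simp del: of_nat_Suc)
    finally show ?thesis .
  qed
  have "(\<lambda>n. integral\<^sup>L \<nu> (birkhoff_average f \<phi> (Suc n))) \<longlonglongrightarrow> integral\<^sup>L \<nu> (\<lambda>_. 0)"
  proof (rule integral_dominated_convergence[where w = "\<lambda>_. M"])
    show "birkhoff_average f \<phi> (Suc n) \<in> borel_measurable \<nu>" for n
      unfolding birkhoff_average_def[abs_def] using im by simp
    show "AE z in \<nu>. (\<lambda>n. birkhoff_average f \<phi> (Suc n) z) \<longlonglongrightarrow> 0"
      using AE by eventually_elim (rule LIMSEQ_Suc)
    show "AE z in \<nu>. norm (birkhoff_average f \<phi> (Suc n) z) \<le> M" for n
    proof (rule AE_I2)
      fix z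
      have "\<bar>\<Sum>i<Suc n. \<phi> ((f ^^ i) z)\<bar> \<le> (\<Sum>i<Suc n. M)"
        by (rule order_trans[OF sum_abs sum_mono]) (rule M)
      then show "norm (birkhoff_average f \<phi> (Suc n) z) \<le> M"
        by (simp add: birkhoff_average_def abs_divide divide_le_eq mult.commute
            del: sum.lessThan_Suc)
    qed
  qed auto
  then have "(\<lambda>n::nat. integral\<^sup>L \<nu> \<phi>) \<longlonglongrightarrow> 0" by (simp add: avg)
  then show ?thesis by (simp add: LIMSEQ_const_iff)
qed

text \<open>
  If an open set meeting \<open>Y\<close> were null, then so would be the set of points whose orbit visits it;
  but almost every orbit does.
\<close>

lemma full_support_of_dense_orbits:
  assumes f: "continuous_on UNIV f" and \<nu>: "invariant_prob f \<nu>"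
    and AE: "AE z in \<nu>. dense_in (forward_orbit f z) Y"
  shows "full_support_in \<nu> Y"
  unfolding full_support_in_def measure_support_def
proof (intro subsetI CollectI allI impI)
  fix y U assume y: "y \<in> Y" and U: "open U \<and> y \<in> U"
  have s: "sets \<nu> = sets borel" and "prob_space \<nu>"
    and inv: "\<And>A. A \<in> sets borel \<Longrightarrow> emeasure \<nu> (f -` A) = emeasure \<nu> A"
    using \<nu> by (auto simp: invariant_prob_def)
  interpret prob_space \<nu> by fact
  have op: "open ((f ^^ i) -` U)" for i
    using U continuous_on_funpow[OF f, of i] by (simp add: open_vimage)
  have eq: "emeasure \<nu> ((f ^^ i) -` U) = emeasure \<nu> U" for i
  proof (induction i)
    case (Suc i)
    have "(f ^^ Suc i) -` U = f -` ((f ^^ i) -` U)"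
      by (auto simp: funpow_swap1)
    then show ?case using Suc inv[of "(f ^^ i) -` U"] op by (simp only: borel_open)
  qed simp
  show "0 < emeasure \<nu> U"
  proof (rule ccontr)
    assume "\<not> 0 < emeasure \<nu> U"
    then have "(f ^^ i) -` U \<in> null_sets \<nu>" for i
      using eq[of i] op[of i] s by (auto simp: null_sets_def)
    then have "\<forall>i. AE z in \<nu>. z \<notin> (f ^^ i) -` U"
      by (blast intro: AE_not_in)
    then have "AE z in \<nu>. \<forall>i. z \<notin> (f ^^ i) -` U"
      using AE_all_countable[of "\<lambda>i z. z \<notin> (f ^^ i) -` U" \<nu>] by blast
    with AE have "AE z in \<nu>. False"
    proof eventually_elim
      case (elim z)
      then have "y \<in> closure (forward_orbit f z)" using y by (auto simp: dense_in_def)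
      then have "U \<inter> forward_orbit f z \<noteq> {}" using U by (metis IntI empty_iff open_Int_closure_eq_empty)
      then show ?case using elim(2) by (auto simp: forward_orbit_def)
    qed
    then show False using AE_False by simp
  qed
qed

section \<open>The limit measures of a controlled orbit\<close>

theorem corollary3:
  fixes f g :: "'a::metric_space \<Rightarrow> 'a" and \<phi> :: "'a \<Rightarrow> real"
    and Y D :: "'a set" and Fp Fm :: "'a set set" and xD :: 'a and \<mu> :: "'a measure"
  assumes "compact (UNIV :: 'a set)"
    and "compact Y"
    and "homeomorphism UNIV UNIV f g"
    and "continuous_on UNIV \<phi>"
    and "flip_flop_family f \<phi> Fp Fm"
    and "sojourns_along f Fp Fm Y"
    and "D \<in> Fp \<union> Fm"
    and "xD \<in> D"
    and "controlled_with_long_sparse_tail f \<phi> Y xD"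
    and "weak_star_limit_of_subsequence (\<lambda>n. empirical_measure f n xD) \<mu>"
  shows "(AE x in \<mu>. dense_in (forward_orbit f x) Y) \<and>
    (AE x in \<mu>. (\<lambda>n. birkhoff_average f \<phi> n x) \<longlonglongrightarrow> 0) \<and>
    (\<forall>P. ergodic_decomposition f \<mu> P \<longrightarrow>
       (AE \<nu> in P. full_support_in \<nu> Y \<and> integral\<^sup>L \<nu> \<phi> = 0))"
proof -
  have f: "continuous_on UNIV f" using assms(3) by (simp add: homeomorphism_def)
  have sets: "sets \<mu> = sets borel" using assms(10) by (simp add: weak_star_limit_of_subsequence_def)
  have "bounded (range \<phi>)"
    using compact_continuous_image[OF assms(4,1)] by (rule compact_imp_bounded)
  then obtain M where M: "\<And>z. \<bar>\<phi> z\<bar> \<le> M" by (auto simp: bounded_iff)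
  obtain T \<epsilon> R \<delta> \<alpha> where tail: "scale T" "controlling_sequence \<epsilon>" "long_sparse_tail T \<epsilon> R"
    and \<delta>: "\<delta> \<longlonglongrightarrow> 0" and \<alpha>: "\<And>n. 0 < \<alpha> n" "\<alpha> \<longlonglongrightarrow> 0"
    and dense: "\<And>n I. is_component R I \<Longrightarrow> card I = T n \<Longrightarrow>
      delta_dense (\<delta> n) ((\<lambda>i. (f ^^ i) xD) ` I) Y"
    and average: "\<And>n k. \<not> scale_interval T n k \<subseteq> tail_from T R (n + 1) \<Longrightarrow>
      (\<Sum>i\<in>scale_interval T n k. \<phi> ((f ^^ i) xD)) / real (T n) \<in> {- \<alpha> n .. \<alpha> n}"
    using assms(9) unfolding controlled_with_long_sparse_tail_def by blast
  interpret sparse_tail T \<epsilon> R by unfold_locales fact+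
  have 1: "AE x in \<mu>. dense_in (forward_orbit f x) Y"
    by (rule AE_dense_orbit[OF f assms(10) \<delta> dense])
  have 2: "AE x in \<mu>. (\<lambda>n. birkhoff_average f \<phi> n x) \<longlonglongrightarrow> 0"
    by (rule AE_birkhoff_average[OF f assms(4) M assms(10) \<alpha>(2,1) average])
  have "AE \<nu> in P. full_support_in \<nu> Y \<and> integral\<^sup>L \<nu> \<phi> = 0"
    if P: "ergodic_decomposition f \<mu> P" for P
  proof -
    have "AE \<nu> in P. ergodic_prob f \<nu>" using P by (simp add: ergodic_decomposition_def)
    with AE_ergodic_component[OF P sets 1] AE_ergodic_component[OF P sets 2]
    show ?thesis
    proof eventually_elim
      case (elim \<nu>)
      then have "invariant_prob f \<nu>" by (simp add: ergodic_prob_def)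
      then show ?case
        using full_support_of_dense_orbits[OF f] integral_eq_0_of_birkhoff_average[OF f assms(4) M]
          elim by blast
    qed
  qed
  with 1 2 show ?thesis by blast
qed

end
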